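(* Let $R$ be an associative algebra over a field $\mathbb{F}$ of characteristic $p>2$ and let $I$ be a two-sided ideal of $R$. If $I$ is associative nilpotent of index $c$ and $R/I^2$ is Lie nilpotent of class $d$, then $\gamma_{\mu(c,d)}(R)=0$, where $\mu(c,d)=2cd-c-d+2$.
   Context: The nilpotence index of a nilpotent subalgebra $B$ of an associative algebra is the least integer $k$ such that $B^{k+1}=0$. For an associative algebra $A$ put $[u,v]=uv-vu$, $\gamma_1(A)=A$, and $\gamma_n(A)=[\gamma_{n-1}(A),A]$ (the subspace spanned by all $[u,v]$ with $u\in\gamma_{n-1}(A)$, $v\in A$) for $n\ge 2$. $A$ is Lie nilpotent if $\gamma_n(A)=0$ for some $n$; its (nilpotence) class is the least integer $m$ such that $\gamma_{m+1}(A)=0$.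
   Formalization: The ideal I is assumed nonzero (index c ≥ 1): for I = 0 the index is c = 0 and the claim fails, e.g. for R nonzero commutative (d = 1) it would say γ_1(R) = R = 0, and for d ≥ 2 the index 2 − d is not positive. *)

theory Defs
  imports "HOL-Algebra.Algebra"
begin

text \<open>
  Associative algebras over a field, not necessarily unital and not necessarily commutative.
  They are carried by the HOL-Algebra record type \<^typ>\<open>('f, 'a) module\<close>;
  its field \<^const>\<open>one\<close> is never constrained nor used.
\<close>

locale assoc_algebra = F: field F + module F A for F and A (structure) +
  assumes alg_m_closed:
      "\<lbrakk>x \<in> carrier A; y \<in> carrier A\<rbrakk> \<Longrightarrow> x \<otimes> y \<in> carrier A"
    and alg_m_assoc:
      "\<lbrakk>x \<in> carrier A; y \<in> carrier A; z \<in> carrier A\<rbrakk> \<Longrightarrow>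
        (x \<otimes> y) \<otimes> z = x \<otimes> (y \<otimes> z)"
    and alg_l_distr:
      "\<lbrakk>x \<in> carrier A; y \<in> carrier A; z \<in> carrier A\<rbrakk> \<Longrightarrow>
        (x \<oplus> y) \<otimes> z = x \<otimes> z \<oplus> y \<otimes> z"
    and alg_r_distr:
      "\<lbrakk>x \<in> carrier A; y \<in> carrier A; z \<in> carrier A\<rbrakk> \<Longrightarrow>
        z \<otimes> (x \<oplus> y) = z \<otimes> x \<oplus> z \<otimes> y"
    and alg_smult_l:
      "\<lbrakk>a \<in> carrier F; x \<in> carrier A; y \<in> carrier A\<rbrakk> \<Longrightarrow>
        (a \<odot> x) \<otimes> y = a \<odot> (x \<otimes> y)"
    and alg_smult_r:
      "\<lbrakk>a \<in> carrier F; x \<in> carrier A; y \<in> carrier A\<rbrakk> \<Longrightarrow>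
        x \<otimes> (a \<odot> y) = a \<odot> (x \<otimes> y)"

text \<open>The additive order of \<open>1\<close>; \<^const>\<open>group.ord\<close> is \<open>0\<close> for elements of infinite order.\<close>

definition field_char :: "('f, 'x) ring_scheme \<Rightarrow> nat" where
  "field_char F = group.ord (add_monoid F) \<one>\<^bsub>F\<^esub>"

definition two_sided_ideal ::
    "('f, 'x) ring_scheme \<Rightarrow> ('f, 'a, 'm) module_scheme \<Rightarrow> 'a set \<Rightarrow> bool" where
  "two_sided_ideal F A I \<longleftrightarrow> submodule I F A \<and>
    (\<forall>x\<in>I. \<forall>r\<in>carrier A. r \<otimes>\<^bsub>A\<^esub> x \<in> I \<and> x \<otimes>\<^bsub>A\<^esub> r \<in> I)"

definition lin_span ::
    "('f, 'x) ring_scheme \<Rightarrow> ('f, 'a, 'm) module_scheme \<Rightarrow> 'a set \<Rightarrow> 'a set" where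
  "lin_span F A S = \<Inter>{H. submodule H F A \<and> S \<subseteq> H}"

text \<open>\<open>B\<close>, \<open>B\<^sup>2\<close>, ... for a subspace \<open>B\<close>; the value at exponent \<open>0\<close> is a dummy.\<close>

fun alg_power ::
    "('f, 'x) ring_scheme \<Rightarrow> ('f, 'a, 'm) module_scheme \<Rightarrow> 'a set \<Rightarrow> nat \<Rightarrow> 'a set" where
  "alg_power F A B 0 = carrier A"
| "alg_power F A B (Suc 0) = B"
| "alg_power F A B (Suc (Suc k)) =
    lin_span F A {u \<otimes>\<^bsub>A\<^esub> v | u v. u \<in> alg_power F A B (Suc k) \<and> v \<in> B}"

definition alg_nilpotent ::
    "('f, 'x) ring_scheme \<Rightarrow> ('f, 'a, 'm) module_scheme \<Rightarrow> 'a set \<Rightarrow> bool" where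
  "alg_nilpotent F A B \<longleftrightarrow> (\<exists>k. alg_power F A B (k + 1) = {\<zero>\<^bsub>A\<^esub>})"

definition nilpotence_index ::
    "('f, 'x) ring_scheme \<Rightarrow> ('f, 'a, 'm) module_scheme \<Rightarrow> 'a set \<Rightarrow> nat" where
  "nilpotence_index F A B = (LEAST k. alg_power F A B (k + 1) = {\<zero>\<^bsub>A\<^esub>})"

definition commutator :: "('f, 'a, 'm) module_scheme \<Rightarrow> 'a \<Rightarrow> 'a \<Rightarrow> 'a" where
  "commutator A u v = u \<otimes>\<^bsub>A\<^esub> v \<ominus>\<^bsub>A\<^esub> v \<otimes>\<^bsub>A\<^esub> u"

text \<open>The lower central series, indexed from \<open>1\<close>; the value at index \<open>0\<close> is a dummy.\<close>

fun lie_gamma ::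
    "('f, 'x) ring_scheme \<Rightarrow> ('f, 'a, 'm) module_scheme \<Rightarrow> nat \<Rightarrow> 'a set" where
  "lie_gamma F A 0 = carrier A"
| "lie_gamma F A (Suc 0) = carrier A"
| "lie_gamma F A (Suc (Suc n)) =
    lin_span F A {commutator A u v | u v. u \<in> lie_gamma F A (Suc n) \<and> v \<in> carrier A}"

definition lie_nilpotent ::
    "('f, 'x) ring_scheme \<Rightarrow> ('f, 'a, 'm) module_scheme \<Rightarrow> bool" where
  "lie_nilpotent F A \<longleftrightarrow> (\<exists>n\<ge>1. lie_gamma F A n = {\<zero>\<^bsub>A\<^esub>})"

definition lie_class ::
    "('f, 'x) ring_scheme \<Rightarrow> ('f, 'a, 'm) module_scheme \<Rightarrow> nat" where
  "lie_class F A = (LEAST m. lie_gamma F A (m + 1) = {\<zero>\<^bsub>A\<^esub>})"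

text \<open>
  \<^const>\<open>FactRing\<close> equipped with the induced scalar multiplication. For an ideal \<open>J\<close>
  the union below is the single coset of \<open>a \<odot> x\<close>, for any \<open>x \<in> C\<close>.
\<close>

definition quot_algebra ::
    "('f, 'a, 'm) module_scheme \<Rightarrow> 'a set \<Rightarrow> ('f, 'a set) module" where
  "quot_algebra A J = ring.extend (A Quot J)
    (module.fields (\<lambda>a C. \<Union>x\<in>C. J +>\<^bsub>A\<^esub> (a \<odot>\<^bsub>A\<^esub> x)))"

lemma quot_algebra_simps [simp]:
  "carrier (quot_algebra A J) = (a_rcosets\<^bsub>A\<^esub> J)"
  "monoid.mult (quot_algebra A J) = rcoset_mult A J"
  "ring.zero (quot_algebra A J) = J"
  "ring.add (quot_algebra A J) = set_add A"
  "module.smult (quot_algebra A J) = (\<lambda>a C. \<Union>x\<in>C. J +>\<^bsub>A\<^esub> (a \<odot>\<^bsub>A\<^esub> x))"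
  by (simp_all add: quot_algebra_def ring.defs module.defs FactRing_def)

text \<open>Only used for \<open>c, d \<ge> 1\<close>, where the subtractions on \<^typ>\<open>nat\<close> do not truncate.\<close>

definition mu :: "nat \<Rightarrow> nat \<Rightarrow> nat" where
  "mu c d = 2 * c * d - c - d + 2"

end

theory Submission
  imports Defs
begin

text \<open>
  Put \<open>N\<^sub>m = I \<inter> \<gamma>\<^sub>m\<^sub>+\<^sub>1(R)\<close> and let \<open>P\<^sub>k(m)\<close> be spanned by the products of \<open>k\<close> factors from
  the \<open>N\<^sub>i\<close> whose weights \<open>i\<close> add up to \<open>m\<close>. By the Leibniz rule \<open>[P\<^sub>k(m), R] \<subseteq> P\<^sub>k(m+1)\<close>,
  so that \<open>\<gamma>\<^sub>d\<^sub>+\<^sub>1(R) \<subseteq> I\<^sup>2 = P\<^sub>2(0)\<close> gives \<open>\<gamma>\<^sub>d\<^sub>+\<^sub>1\<^sub>+\<^sub>m(R) \<subseteq> P\<^sub>2(m)\<close>.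
  If \<open>m > k(d-1)\<close>, every product of total weight \<open>m\<close> has a factor of weight \<open>i \<ge> d\<close>; this factor
  lies in \<open>\<gamma>\<^sub>i\<^sub>+\<^sub>1(R) \<subseteq> P\<^sub>2(i-d)\<close>, whence \<open>P\<^sub>k(m) \<subseteq> P\<^sub>k\<^sub>+\<^sub>1(m-d)\<close>. The index \<open>\<mu>(c,d)\<close> is what
  is needed to repeat this step until \<open>k = c + 1\<close>, and \<open>P\<^sub>c\<^sub>+\<^sub>1(m) \<subseteq> I\<^sup>c\<^sup>+\<^sup>1 = 0\<close>.
\<close>

section \<open>Submodules and spans\<close>

context assoc_algebra
begin

text \<open>Negation is scaling by the negative of the field's one, so closure under it follows from
  closure under scalars.\<close>

lemma submodule_by_smult:
  assumes "H \<subseteq> carrier A" "\<zero> \<in> H"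
    and "\<And>x y. \<lbrakk>x \<in> H; y \<in> H\<rbrakk> \<Longrightarrow> x \<oplus> y \<in> H"
    and smult: "\<And>a x. \<lbrakk>a \<in> carrier F; x \<in> H\<rbrakk> \<Longrightarrow> a \<odot> x \<in> H"
  shows "submodule H F A"
proof (rule submoduleI)
  fix x assume x: "x \<in> H"
  then have "\<ominus> x = (\<ominus>\<^bsub>F\<^esub> \<one>\<^bsub>F\<^esub>) \<odot> x"
    using assms(1) by (auto simp: smult_l_minus)
  then show "\<ominus> x \<in> H" using smult x by simp
qed (use assms in auto)

lemma submodule_zero: "submodule H F A \<Longrightarrow> \<zero> \<in> H"
  using subgroup.one_closed[OF submodule.axioms(1)] by fastforce

lemma submodule_diff:
  assumes "submodule H F A" "x \<in> H" "y \<in> H"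
  shows "x \<ominus> y \<in> H"
  using submoduleE(3,5)[OF assms(1)] assms(2,3) by (simp add: M.minus_eq)

lemma submodule_Inter:
  assumes "\<H> \<noteq> {}" "\<And>H. H \<in> \<H> \<Longrightarrow> submodule H F A"
  shows "submodule (\<Inter>\<H>) F A"
proof (rule submodule_by_smult)
  show "\<Inter>\<H> \<subseteq> carrier A"
    using assms submoduleE(1) by blast
  show "\<zero> \<in> \<Inter>\<H>"
    using assms(2) submodule_zero by blast
  show "x \<oplus> y \<in> \<Inter>\<H>" if "x \<in> \<Inter>\<H>" "y \<in> \<Inter>\<H>" for x y
    using that assms(2) submoduleE(5) by (meson Inter_iff)
  show "a \<odot> x \<in> \<Inter>\<H>" if "a \<in> carrier F" "x \<in> \<Inter>\<H>" for a x
    using that assms(2) submoduleE(4) by (meson Inter_iff)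
qed

lemma lin_span_superset: "S \<subseteq> lin_span F A S"
  by (auto simp: lin_span_def)

lemma lin_span_minimal: "\<lbrakk>submodule H F A; S \<subseteq> H\<rbrakk> \<Longrightarrow> lin_span F A S \<subseteq> H"
  by (auto simp: lin_span_def)

lemma submodule_lin_span:
  assumes "S \<subseteq> carrier A"
  shows "submodule (lin_span F A S) F A"
  unfolding lin_span_def
  using assms carrier_is_submodule by (intro submodule_Inter) auto

lemma alg_r_null [simp]: "x \<in> carrier A \<Longrightarrow> x \<otimes> \<zero> = \<zero>"
  by (metis F.zero_closed M.zero_closed alg_m_closed alg_smult_r smult_l_null)

lemma alg_l_null [simp]: "x \<in> carrier A \<Longrightarrow> \<zero> \<otimes> x = \<zero>"
  by (metis F.zero_closed M.zero_closed alg_m_closed alg_smult_l smult_l_null)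

lemma alg_r_minus:
  assumes "x \<in> carrier A" "y \<in> carrier A"
  shows "x \<otimes> (\<ominus> y) = \<ominus> (x \<otimes> y)"
proof -
  have "x \<otimes> ((\<ominus>\<^bsub>F\<^esub> \<one>\<^bsub>F\<^esub>) \<odot> y) = (\<ominus>\<^bsub>F\<^esub> \<one>\<^bsub>F\<^esub>) \<odot> (x \<otimes> y)"
    using assms by (simp add: alg_smult_r)
  then show ?thesis using assms by (simp add: smult_l_minus alg_m_closed)
qed

lemma alg_l_minus:
  assumes "x \<in> carrier A" "y \<in> carrier A"
  shows "(\<ominus> x) \<otimes> y = \<ominus> (x \<otimes> y)"
proof -
  have "((\<ominus>\<^bsub>F\<^esub> \<one>\<^bsub>F\<^esub>) \<odot> x) \<otimes> y = (\<ominus>\<^bsub>F\<^esub> \<one>\<^bsub>F\<^esub>) \<odot> (x \<otimes> y)"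
    using assms by (simp add: alg_smult_l)
  then show ?thesis using assms by (simp add: smult_l_minus alg_m_closed)
qed

text \<open>Together with \<open>lin_span_minimal\<close>, this reduces statements about products
  with a whole span to its generators.\<close>

lemma submodule_vimage_mult_left:
  assumes "submodule H F A" "x \<in> carrier A"
  shows "submodule {y \<in> carrier A. x \<otimes> y \<in> H} F A"
  using assms submodule_zero submoduleE(4,5)[OF assms(1)]
  by (intro submodule_by_smult) (auto simp: alg_r_distr alg_smult_r)

lemma submodule_vimage_mult_right:
  assumes "submodule H F A" "x \<in> carrier A"
  shows "submodule {y \<in> carrier A. y \<otimes> x \<in> H} F A"
  using assms submodule_zero submoduleE(4,5)[OF assms(1)]
  by (intro submodule_by_smult) (auto simp: alg_l_distr alg_smult_l)

section \<open>Commutators and the lower central series\<close>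

lemma commutator_closed [simp]:
  "\<lbrakk>x \<in> carrier A; r \<in> carrier A\<rbrakk> \<Longrightarrow> commutator A x r \<in> carrier A"
  by (simp add: commutator_def alg_m_closed)

lemma commutator_zero [simp]: "r \<in> carrier A \<Longrightarrow> commutator A \<zero> r = \<zero>"
  by (simp add: commutator_def M.minus_eq)

lemma commutator_add:
  assumes "x \<in> carrier A" "y \<in> carrier A" "r \<in> carrier A"
  shows "commutator A (x \<oplus> y) r = commutator A x r \<oplus> commutator A y r"
  using assms
  by (simp add: commutator_def M.minus_eq alg_l_distr alg_r_distr alg_m_closed M.minus_add M.a_ac)

lemma commutator_smult:
  assumes "a \<in> carrier F" "x \<in> carrier A" "r \<in> carrier A"
  shows "commutator A (a \<odot> x) r = a \<odot> commutator A x r"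
  using assms
  by (simp add: commutator_def M.minus_eq alg_smult_l alg_smult_r alg_m_closed smult_r_distr
      smult_r_minus)

text \<open>The Leibniz rule: bracketing with \<open>r\<close> is a derivation of the
  product.\<close>

lemma commutator_mult:
  assumes "u \<in> carrier A" "v \<in> carrier A" "r \<in> carrier A"
  shows "commutator A (u \<otimes> v) r = u \<otimes> commutator A v r \<oplus> commutator A u r \<otimes> v"
proof -
  \<comment> \<open>The inserted \<open>b\<close> becomes the product \<open>u r v\<close>, which
    occurs with opposite signs in the two summands of the rule.\<close>
  have "a \<oplus> \<ominus> c = (a \<oplus> \<ominus> b) \<oplus> (b \<oplus> \<ominus> c)"
    if "a \<in> carrier A" "b \<in> carrier A" "c \<in> carrier A" for a b c
    using that by (simp add: M.a_assoc M.r_neg1 M.r_neg2)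
  from this[of "u \<otimes> (v \<otimes> r)" "u \<otimes> (r \<otimes> v)" "r \<otimes> (u \<otimes> v)"] show ?thesis
    using assms
    by (simp add: commutator_def M.minus_eq alg_m_closed alg_m_assoc alg_r_distr alg_l_distr
        alg_r_minus alg_l_minus)
qed

lemma lie_gamma_Suc:
  "n \<ge> 1 \<Longrightarrow> lie_gamma F A (Suc n) =
    lin_span F A {commutator A u v | u v. u \<in> lie_gamma F A n \<and> v \<in> carrier A}"
  by (cases n) auto

lemma lie_gamma_submodule: "submodule (lie_gamma F A n) F A"
proof (induction n)
  case (Suc n)
  show ?case
  proof (cases n)
    case (Suc k)
    have "lie_gamma F A n \<subseteq> carrier A" using submoduleE(1)[OF Suc.IH] .
    then show ?thesis
      using Suc by (simp only: lie_gamma.simps, intro submodule_lin_span) auto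
  qed (simp add: carrier_is_submodule)
qed (simp add: carrier_is_submodule)

lemma commutator_in_lie_gamma:
  "\<lbrakk>n \<ge> 1; x \<in> lie_gamma F A n; r \<in> carrier A\<rbrakk> \<Longrightarrow> commutator A x r \<in> lie_gamma F A (Suc n)"
  using lin_span_superset by (fastforce simp: lie_gamma_Suc)

lemma lie_gamma_Suc_subset:
  assumes "n \<ge> 1" "submodule H F A"
    and "\<And>x r. \<lbrakk>x \<in> lie_gamma F A n; r \<in> carrier A\<rbrakk> \<Longrightarrow> commutator A x r \<in> H"
  shows "lie_gamma F A (Suc n) \<subseteq> H"
  unfolding lie_gamma_Suc[OF assms(1)] using assms(2,3) by (intro lin_span_minimal) auto

end

section \<open>Powers of an ideal\<close>

locale alg_ideal = assoc_algebra F A for F and A (structure) +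
  fixes I
  assumes ideal: "two_sided_ideal F A I"
begin

lemma I_submodule: "submodule I F A"
  using ideal by (simp add: two_sided_ideal_def)

lemma I_subset: "I \<subseteq> carrier A"
  using submoduleE(1)[OF I_submodule] .

lemma I_mult_left: "\<lbrakk>r \<in> carrier A; x \<in> I\<rbrakk> \<Longrightarrow> r \<otimes> x \<in> I"
  and I_mult_right: "\<lbrakk>r \<in> carrier A; x \<in> I\<rbrakk> \<Longrightarrow> x \<otimes> r \<in> I"
  using ideal by (auto simp: two_sided_ideal_def)

lemma commutator_in_I: "\<lbrakk>x \<in> I; r \<in> carrier A\<rbrakk> \<Longrightarrow> commutator A x r \<in> I"
  unfolding commutator_def by (intro submodule_diff[OF I_submodule] I_mult_left I_mult_right)

lemma alg_power_Suc:
  "n \<ge> 1 \<Longrightarrow> alg_power F A I (Suc n) =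
    lin_span F A {u \<otimes> v | u v. u \<in> alg_power F A I n \<and> v \<in> I}"
  by (cases n) auto

lemma alg_power_submodule: "submodule (alg_power F A I n) F A"
proof (induction n)
  case (Suc n)
  show ?case
  proof (cases n)
    case (Suc k)
    have "alg_power F A I n \<subseteq> carrier A" using submoduleE(1)[OF Suc.IH] .
    then show ?thesis
      using Suc I_subset
      by (simp only: alg_power.simps, intro submodule_lin_span) (auto intro!: alg_m_closed)
  qed (simp add: I_submodule)
qed (simp add: carrier_is_submodule)

lemma alg_power_subset: "alg_power F A I n \<subseteq> carrier A"
  using submoduleE(1)[OF alg_power_submodule] .

lemma alg_power_Suc_subset:
  assumes "n \<ge> 1" "submodule H F A"
    and "\<And>u v. \<lbrakk>u \<in> alg_power F A I n; v \<in> I\<rbrakk> \<Longrightarrow> u \<otimes> v \<in> H"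
  shows "alg_power F A I (Suc n) \<subseteq> H"
  unfolding alg_power_Suc[OF assms(1)] using assms(2,3) by (intro lin_span_minimal) auto

lemma mult_in_alg_power_Suc:
  "\<lbrakk>n \<ge> 1; u \<in> alg_power F A I n; v \<in> I\<rbrakk> \<Longrightarrow> u \<otimes> v \<in> alg_power F A I (Suc n)"
  using lin_span_superset by (fastforce simp: alg_power_Suc)

text \<open>\<open>alg_power\<close> appends single factors on the right, so a general right factor
  is split by induction on \<open>l\<close> and reassociated.\<close>

lemma mult_in_alg_power:
  assumes k: "k \<ge> 1" and u: "u \<in> alg_power F A I k"
  shows "l \<ge> 1 \<Longrightarrow> v \<in> alg_power F A I l \<Longrightarrow> u \<otimes> v \<in> alg_power F A I (k + l)"
proof (induction l arbitrary: v rule: nat_induct_at_least)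
  case base
  then show ?case using mult_in_alg_power_Suc[OF k u] by simp
next
  case (Suc l)
  have uA: "u \<in> carrier A" using u alg_power_subset by blast
  have "alg_power F A I (Suc l) \<subseteq> {v \<in> carrier A. u \<otimes> v \<in> alg_power F A I (k + Suc l)}"
  proof (rule alg_power_Suc_subset[OF Suc.hyps])
    show "submodule {v \<in> carrier A. u \<otimes> v \<in> alg_power F A I (k + Suc l)} F A"
      by (rule submodule_vimage_mult_left[OF alg_power_submodule uA])
  next
    fix w v assume w: "w \<in> alg_power F A I l" and v: "v \<in> I"
    have "w \<in> carrier A" "v \<in> carrier A" using w v alg_power_subset I_subset by blast+
    moreover have "(u \<otimes> w) \<otimes> v \<in> alg_power F A I (k + Suc l)"
      using mult_in_alg_power_Suc[OF _ Suc.IH[OF w] v] k by simp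
    ultimately show "w \<otimes> v \<in> {v \<in> carrier A. u \<otimes> v \<in> alg_power F A I (k + Suc l)}"
      using uA by (simp add: alg_m_closed alg_m_assoc)
  qed
  then show ?case using Suc.prems by blast
qed

text \<open>Left multipliers are absorbed by the factor from the lower power, right ones by the last
  factor in \<open>I\<close>. The case of exponent 2 allows passing to the quotient by the square of
  \<open>I\<close>.\<close>

lemma two_sided_ideal_alg_power:
  "n \<ge> 1 \<Longrightarrow> two_sided_ideal F A (alg_power F A I n)"
proof (induction n rule: nat_induct_at_least)
  case base
  then show ?case using ideal by simp
next
  case (Suc n)
  let ?J = "alg_power F A I (Suc n)"
  have closed: "r \<otimes> x \<in> ?J \<and> x \<otimes> r \<in> ?J" if x: "x \<in> ?J" and r: "r \<in> carrier A" for x r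
  proof -
    have uv: "u \<otimes> v \<in> carrier A" "r \<otimes> (u \<otimes> v) \<in> ?J" "(u \<otimes> v) \<otimes> r \<in> ?J"
      if u: "u \<in> alg_power F A I n" and v: "v \<in> I" for u v
    proof -
      have uv: "u \<in> carrier A" "v \<in> carrier A" using u v alg_power_subset I_subset by blast+
      then show "u \<otimes> v \<in> carrier A" by (rule alg_m_closed)
      have "(r \<otimes> u) \<otimes> v \<in> ?J"
        using mult_in_alg_power_Suc[OF Suc.hyps _ v] Suc.IH u r by (simp add: two_sided_ideal_def)
      then show "r \<otimes> (u \<otimes> v) \<in> ?J" using uv r by (simp add: alg_m_assoc)
      have "u \<otimes> (v \<otimes> r) \<in> ?J"
        using mult_in_alg_power_Suc[OF Suc.hyps u I_mult_right[OF r v]] .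
      then show "(u \<otimes> v) \<otimes> r \<in> ?J" using uv r by (simp add: alg_m_assoc)
    qed
    have "?J \<subseteq> {y \<in> carrier A. r \<otimes> y \<in> ?J}"
      using submodule_vimage_mult_left[OF alg_power_submodule r] uv
      by (intro alg_power_Suc_subset[OF Suc.hyps]) auto
    moreover have "?J \<subseteq> {y \<in> carrier A. y \<otimes> r \<in> ?J}"
      using submodule_vimage_mult_right[OF alg_power_submodule r] uv
      by (intro alg_power_Suc_subset[OF Suc.hyps]) auto
    ultimately show ?thesis using x by blast
  qed
  show ?case
    unfolding two_sided_ideal_def by (intro conjI ballI alg_power_submodule closed[THEN conjunct1] closed[THEN conjunct2])
qed

section \<open>The quotient algebra\<close>

sublocale I: abelian_subgroup I A
  by (intro abelian_subgroupI3 additive_subgroupI submodule.axioms(1)[OF I_submodule]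
      M.abelian_group_axioms)

text \<open>\<open>rcoset_mult\<close> is a union over all pairs of representatives. For
  \<open>a = i + x\<close> and \<open>b = j + y\<close> the product \<open>a b\<close> differs from
  \<open>x y\<close> by \<open>i b + x j\<close>, which lies in \<open>I\<close>, so the union is
  one coset.\<close>

lemma quot_mult:
  assumes "x \<in> carrier A" "y \<in> carrier A"
  shows "(I +> x) \<otimes>\<^bsub>quot_algebra A I\<^esub> (I +> y) = I +> (x \<otimes> y)"
proof -
  have "I +> (a \<otimes> b) = I +> (x \<otimes> y)" if "a \<in> I +> x" "b \<in> I +> y" for a b
  proof -
    obtain i j where ij: "i \<in> I" "a = i \<oplus> x" "j \<in> I" "b = j \<oplus> y"
      using \<open>a \<in> I +> x\<close> \<open>b \<in> I +> y\<close> by (auto simp: a_r_coset_def')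
    have c: "i \<in> carrier A" "j \<in> carrier A" "b \<in> carrier A" using ij assms I_subset by auto
    have "a \<otimes> b = (i \<otimes> b \<oplus> x \<otimes> j) \<oplus> x \<otimes> y"
      using ij c assms by (simp add: alg_l_distr alg_r_distr alg_m_closed M.a_ac)
    moreover have "i \<otimes> b \<oplus> x \<otimes> j \<in> I"
      using ij c assms I_mult_left I_mult_right by blast
    ultimately have "a \<otimes> b \<in> I +> (x \<otimes> y)" by (auto simp: a_r_coset_def')
    then show ?thesis using assms by (metis I.a_repr_independence' alg_m_closed)
  qed
  moreover have "I +> x \<noteq> {}" "I +> y \<noteq> {}"
    using assms I.a_rcos_self by blast+
  ultimately show ?thesis by (simp add: rcoset_mult_def)
qed

lemma quot_smult:
  assumes "a \<in> carrier F" "x \<in> carrier A"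
  shows "a \<odot>\<^bsub>quot_algebra A I\<^esub> (I +> x) = I +> (a \<odot> x)"
proof -
  have "I +> (a \<odot> y) = I +> (a \<odot> x)" if "y \<in> I +> x" for y
  proof -
    obtain i where i: "i \<in> I" "y = i \<oplus> x"
      using \<open>y \<in> I +> x\<close> by (auto simp: a_r_coset_def')
    then have "a \<odot> y = a \<odot> i \<oplus> a \<odot> x" using assms I_subset by (auto simp: smult_r_distr)
    moreover have "a \<odot> i \<in> I" using submoduleE(4)[OF I_submodule] assms i by blast
    ultimately have "a \<odot> y \<in> I +> (a \<odot> x)" by (auto simp: a_r_coset_def')
    then show ?thesis using assms by (metis I.a_repr_independence' smult_closed)
  qed
  moreover have "I +> x \<noteq> {}" using assms I.a_rcos_self by blast
  ultimately show ?thesis by simp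
qed

lemma quot_add:
  "\<lbrakk>x \<in> carrier A; y \<in> carrier A\<rbrakk> \<Longrightarrow>
    (I +> x) \<oplus>\<^bsub>quot_algebra A I\<^esub> (I +> y) = I +> (x \<oplus> y)"
  by (simp add: I.a_rcos_sum)

lemma quot_a_inv:
  assumes "x \<in> carrier A"
  shows "\<ominus>\<^bsub>quot_algebra A I\<^esub> (I +> x) = I +> (\<ominus> x)"
proof -
  \<comment> \<open>The additive part of the quotient algebra and the factor group have the same
    carrier, operation and neutral element.\<close>
  have "\<ominus>\<^bsub>quot_algebra A I\<^esub> (I +> x) = inv\<^bsub>A A_Mod I\<^esub> (I +> x)"
    by (simp add: a_inv_def m_inv_def A_FactGroup_defs A_RCOSETS_def set_add_def)
  moreover have "I +> x \<in> carrier (A A_Mod I)"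
    using assms I_subset by (simp add: A_FactGroup_def' a_rcosetsI)
  then have "inv\<^bsub>A A_Mod I\<^esub> (I +> x) = I +> (\<ominus> x)"
    using assms by (simp add: I.a_inv_FactGroup I.a_rcos_inv)
  ultimately show ?thesis by simp
qed

lemma quot_commutator:
  assumes "x \<in> carrier A" "y \<in> carrier A"
  shows "commutator (quot_algebra A I) (I +> x) (I +> y) = I +> commutator A x y"
proof -
  have xy: "x \<otimes> y \<in> carrier A" "y \<otimes> x \<in> carrier A" using assms alg_m_closed by blast+
  show ?thesis
    unfolding commutator_def a_minus_def quot_mult[OF assms] quot_mult[OF assms(2,1)]
      quot_a_inv[OF xy(2)] quot_add[OF xy(1) M.a_inv_closed[OF xy(2)]] ..
qed

lemma submodule_vimage_quot:
  assumes H: "submodule H F (quot_algebra A I)"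
  shows "submodule {x \<in> carrier A. I +> x \<in> H} F A"
proof (rule submodule_by_smult)
  interpret H: subgroup H "add_monoid (quot_algebra A I)"
    using H by (rule submodule.axioms(1))
  show "\<zero> \<in> {x \<in> carrier A. I +> x \<in> H}"
    using H.one_closed I_subset by simp
  show "x \<oplus> y \<in> {x \<in> carrier A. I +> x \<in> H}"
    if "x \<in> {x \<in> carrier A. I +> x \<in> H}" "y \<in> {x \<in> carrier A. I +> x \<in> H}" for x y
    using that H.m_closed[of "I +> x" "I +> y"] quot_add[of x y] by simp
  show "a \<odot> x \<in> {x \<in> carrier A. I +> x \<in> H}"
    if "a \<in> carrier F" "x \<in> {x \<in> carrier A. I +> x \<in> H}" for a x
    using that submodule.smult_closed[OF H, of a "I +> x"] quot_smult[of a x]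
    by (simp del: quot_algebra_simps)
qed auto

text \<open>The span in the quotient is an intersection of subspaces \<open>H\<close>, so it
  suffices to pull back each \<open>H\<close> containing the commutators. This needs no proof that
  the quotient is itself an algebra.\<close>

lemma lie_gamma_quot:
  "lie_gamma F A n \<subseteq> {x \<in> carrier A. I +> x \<in> lie_gamma F (quot_algebra A I) n}"
proof (induction n)
  case 0
  show ?case using I_subset by (auto intro: a_rcosetsI)
next
  case (Suc n)
  show ?case
  proof (cases n)
    case 0
    then show ?thesis using I_subset by (auto intro: a_rcosetsI)
  next
    case n: (Suc k)
    have "x \<in> {x \<in> carrier A. I +> x \<in> H}"
      if x: "x \<in> lie_gamma F A (Suc n)" and H: "submodule H F (quot_algebra A I)"
        and sub: "{commutator (quot_algebra A I) u v | u v.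
          u \<in> lie_gamma F (quot_algebra A I) n \<and> v \<in> carrier (quot_algebra A I)} \<subseteq> H" for x H
    proof -
      have "lie_gamma F A (Suc n) \<subseteq> {x \<in> carrier A. I +> x \<in> H}"
      proof (rule lie_gamma_Suc_subset[OF _ submodule_vimage_quot[OF H]])
        show "n \<ge> 1" using n by simp
      next
        fix x r assume x: "x \<in> lie_gamma F A n" and r: "r \<in> carrier A"
        have "I +> r \<in> carrier (quot_algebra A I)" using r I_subset by (simp add: a_rcosetsI)
        moreover have "x \<in> carrier A" "I +> x \<in> lie_gamma F (quot_algebra A I) n"
          using Suc.IH x by auto
        ultimately have "commutator (quot_algebra A I) (I +> x) (I +> r) \<in> H"
          using sub by blast
        then show "commutator A x r \<in> {x \<in> carrier A. I +> x \<in> H}"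
          using \<open>x \<in> carrier A\<close> r by (simp add: quot_commutator)
      qed
      then show ?thesis using x by blast
    qed
    moreover have "lie_gamma F A (Suc n) \<subseteq> carrier A"
      by (rule submoduleE(1)[OF lie_gamma_submodule])
    ultimately show ?thesis
      unfolding n lie_gamma.simps(3)[of F "quot_algebra A I"] lin_span_def[of F "quot_algebra A I"]
      by blast
  qed
qed

lemma lie_gamma_subset_ideal:
  assumes "lie_gamma F (quot_algebra A I) n = {\<zero>\<^bsub>quot_algebra A I\<^esub>}"
  shows "lie_gamma F A n \<subseteq> I"
proof
  fix x assume "x \<in> lie_gamma F A n"
  then have "x \<in> carrier A" "I +> x \<in> {\<zero>\<^bsub>quot_algebra A I\<^esub>}"
    using lie_gamma_quot[of n] unfolding assms by blast+
  then show "x \<in> I" using a_coset_join1[OF _ _ I.a_subgroup] by simp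
qed

section \<open>Weighted products\<close>

text \<open>\<open>k\<close> counts factors and \<open>m\<close> is the total weight. Closure rules
  replace an explicit span, so that facts about all products follow by rule induction. The index
  shift in \<open>base\<close> gives every element of \<open>I\<close> weight 0; the bound in
  \<open>zero\<close> keeps \<open>k = 0\<close> empty.\<close>

inductive in_weighted_power :: "nat \<Rightarrow> nat \<Rightarrow> 'c \<Rightarrow> bool" where
  base: "\<lbrakk>x \<in> I; x \<in> lie_gamma F A (Suc m)\<rbrakk> \<Longrightarrow> in_weighted_power 1 m x"
| mult: "\<lbrakk>in_weighted_power k m u; in_weighted_power l n v\<rbrakk> \<Longrightarrow>
    in_weighted_power (k + l) (m + n) (u \<otimes> v)"
| zero: "k \<ge> 1 \<Longrightarrow> in_weighted_power k m \<zero>"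
| add: "\<lbrakk>in_weighted_power k m x; in_weighted_power k m y\<rbrakk> \<Longrightarrow>
    in_weighted_power k m (x \<oplus> y)"
| smult: "\<lbrakk>a \<in> carrier F; in_weighted_power k m x\<rbrakk> \<Longrightarrow> in_weighted_power k m (a \<odot> x)"

text \<open>The subspace \<open>P\<^sub>k(m)\<close>.\<close>

definition weighted_power :: "nat \<Rightarrow> nat \<Rightarrow> 'c set" where
  "weighted_power k m = {x. in_weighted_power k m x}"

lemma in_weighted_power_iff: "in_weighted_power k m x \<longleftrightarrow> x \<in> weighted_power k m"
  by (simp add: weighted_power_def)

lemmas weighted_power_base = in_weighted_power.base[unfolded in_weighted_power_iff]
  and weighted_power_mult = in_weighted_power.mult[unfolded in_weighted_power_iff]
  and weighted_power_zero = in_weighted_power.zero[unfolded in_weighted_power_iff]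
  and weighted_power_add = in_weighted_power.add[unfolded in_weighted_power_iff]
  and weighted_power_smult = in_weighted_power.smult[unfolded in_weighted_power_iff]

lemmas weighted_power_induct [consumes 1, case_names base mult zero add smult] =
  in_weighted_power.induct[unfolded in_weighted_power_iff]

lemma weighted_power_subset: "x \<in> weighted_power k m \<Longrightarrow> x \<in> carrier A"
  by (induction rule: weighted_power_induct) (use I_subset in \<open>auto intro: alg_m_closed\<close>)

lemma weighted_power_pos: "x \<in> weighted_power k m \<Longrightarrow> k \<ge> 1"
  by (induction rule: weighted_power_induct) auto

lemma weighted_power_submodule: "k \<ge> 1 \<Longrightarrow> submodule (weighted_power k m) F A"
  using weighted_power_subset
  by (intro submodule_by_smult weighted_power_zero weighted_power_add weighted_power_smult) auto

text \<open>The derivation acts on one factor at a time and raises its weight by one; that factor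
  stays in \<open>I\<close> because \<open>I\<close> is an ideal.\<close>

lemma commutator_in_weighted_power:
  assumes "x \<in> weighted_power k m" and r: "r \<in> carrier A"
  shows "commutator A x r \<in> weighted_power k (Suc m)"
  using assms(1)
proof (induction rule: weighted_power_induct)
  case (base x m)
  then show ?case
    using r by (intro weighted_power_base commutator_in_I commutator_in_lie_gamma) auto
next
  case (mult k m u l n v)
  then have "commutator A (u \<otimes> v) r = u \<otimes> commutator A v r \<oplus> commutator A u r \<otimes> v"
    using r by (blast intro: commutator_mult weighted_power_subset)
  moreover have "u \<otimes> commutator A v r \<in> weighted_power (k + l) (Suc (m + n))"
    using weighted_power_mult[OF mult.hyps(1) mult.IH(2)] by simp
  moreover have "commutator A u r \<otimes> v \<in> weighted_power (k + l) (Suc (m + n))"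
    using weighted_power_mult[OF mult.IH(1) mult.hyps(2)] by simp
  ultimately show ?case by (simp add: weighted_power_add)
next
  case (add k m x y)
  then show ?case
    using r by (simp add: commutator_add weighted_power_subset weighted_power_add)
next
  case (smult a k m x)
  then show ?case
    using r by (simp add: commutator_smult weighted_power_subset weighted_power_smult)
qed (use r in \<open>simp add: weighted_power_zero\<close>)

text \<open>Forgets the weights. Positivity of the factor counts avoids the dummy exponent 0 of
  \<open>alg_power\<close>.\<close>

lemma weighted_power_subset_alg_power: "weighted_power k m \<subseteq> alg_power F A I k"
proof
  show "x \<in> alg_power F A I k" if "x \<in> weighted_power k m" for x
    using that
  proof (induction rule: weighted_power_induct)
    case (mult k m u l n v)
    then show ?case by (intro mult_in_alg_power weighted_power_pos)
  qed (simp_all add: submodule_zero[OF alg_power_submodule]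
      submoduleE(4,5)[OF alg_power_submodule])
qed

lemma lie_gamma_subset_weighted_power:
  assumes "lie_gamma F A (Suc d) \<subseteq> alg_power F A I 2"
  shows "lie_gamma F A (Suc (d + m)) \<subseteq> weighted_power 2 m"
proof (induction m)
  case 0
  have "alg_power F A I (Suc 1) \<subseteq> weighted_power 2 0"
  proof (rule alg_power_Suc_subset)
    fix u v assume "u \<in> alg_power F A I 1" "v \<in> I"
    then have "u \<in> weighted_power 1 0" "v \<in> weighted_power 1 0"
      using I_subset by (auto intro!: weighted_power_base[of _ 0, simplified])
    then show "u \<otimes> v \<in> weighted_power 2 0"
      using weighted_power_mult[of u 1 0 v 1 0] by (simp add: numeral_2_eq_2)
  qed (simp_all add: weighted_power_submodule)
  then show ?case using assms by (simp add: numeral_2_eq_2)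
next
  case (Suc m)
  then have "lie_gamma F A (Suc (Suc (d + m))) \<subseteq> weighted_power 2 (Suc m)"
    by (intro lie_gamma_Suc_subset weighted_power_submodule commutator_in_weighted_power) auto
  then show ?case by simp
qed

text \<open>Here \<open>Suc f\<close> is the class \<open>d\<close>. A pigeonhole argument finds a
  factor of weight above \<open>f\<close>; it is traded for two factors at the cost of
  \<open>d\<close> units of weight.\<close>

lemma weighted_power_step:
  assumes gamma: "lie_gamma F A (Suc (Suc f)) \<subseteq> alg_power F A I 2"
    and "x \<in> weighted_power k m" "m > k * f"
  shows "x \<in> weighted_power (Suc k) (m - Suc f)"
  using assms(2,3)
proof (induction rule: weighted_power_induct)
  case (base x m)
  then have "Suc m = Suc (Suc f + (m - Suc f))" by simp
  then have "x \<in> weighted_power 2 (m - Suc f)"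
    using base lie_gamma_subset_weighted_power[OF gamma, of "m - Suc f"] by auto
  then show ?case by (simp add: numeral_2_eq_2)
next
  case (mult k m u l n v)
  \<comment> \<open>The pigeonhole: if both inequalities failed, adding them would bound
    \<open>m + n\<close> by \<open>(k + l) * f\<close>.\<close>
  from mult.prems have "m > k * f \<or> n > l * f" by (auto simp: algebra_simps)
  then show ?case
  proof
    assume m: "m > k * f"
    \<comment> \<open>As \<open>k\<close> is positive, \<open>m\<close> is at least
      \<open>Suc f\<close>, and the subtraction does not truncate.\<close>
    have "f \<le> k * f" using weighted_power_pos[OF mult.hyps(1)] by simp
    then have "m - Suc f + n = m + n - Suc f" using m by linarith
    then show ?thesis using weighted_power_mult[OF mult.IH(1)[OF m] mult.hyps(2)] by simp
  next
    assume n: "n > l * f"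
    have "f \<le> l * f" using weighted_power_pos[OF mult.hyps(2)] by simp
    then have "m + (n - Suc f) = m + n - Suc f" using n by linarith
    then show ?thesis using weighted_power_mult[OF mult.hyps(1) mult.IH(2)[OF n]] by simp
  qed
qed (simp_all add: weighted_power_zero weighted_power_add weighted_power_smult)

text \<open>With \<open>d = Suc f\<close> and \<open>c = Suc e\<close>, the start is two factors of
  weight \<open>e * (2 * f + 1)\<close>. Each of the \<open>e\<close> trading steps adds a factor
  and costs \<open>Suc f\<close>, ending with \<open>c + 1\<close> factors.\<close>

lemma lie_gamma_subset_alg_power:
  assumes gamma: "lie_gamma F A (Suc (Suc f)) \<subseteq> alg_power F A I 2"
  shows "lie_gamma F A (Suc (Suc f + e * (2 * f + 1))) \<subseteq> alg_power F A I (e + 2)"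
proof -
  have "lie_gamma F A (Suc (Suc f + e * (2 * f + 1)))
      \<subseteq> weighted_power (j + 2) (e * (2 * f + 1) - j * Suc f)" if "j \<le> e" for j
    using that
  proof (induction j)
    case 0
    then show ?case
      using lie_gamma_subset_weighted_power[OF gamma, of "e * (2 * f + 1)"]
      by (simp only: add_0 mult_0 diff_zero)
  next
    case (Suc j)
    have "Suc j * (2 * f + 1) \<le> e * (2 * f + 1)" using Suc.prems by (rule mult_le_mono1)
    \<comment> \<open>\<open>(j + 2) * f + j * Suc f\<close> is
      \<open>Suc j * (2 * f + 1) - 1\<close>, so the weight suffices exactly while
      \<open>Suc j \<le> e\<close>.\<close>
    then have "(j + 2) * f < e * (2 * f + 1) - j * Suc f" by (simp add: algebra_simps)
    then have step: "weighted_power (j + 2) (e * (2 * f + 1) - j * Suc f)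
        \<subseteq> weighted_power (Suc (j + 2)) (e * (2 * f + 1) - j * Suc f - Suc f)"
      using weighted_power_step[OF gamma] by blast
    have "Suc j + 2 = Suc (j + 2)"
      "e * (2 * f + 1) - Suc j * Suc f = e * (2 * f + 1) - j * Suc f - Suc f"
      by simp_all
    then show ?case
      using subset_trans[OF Suc.IH[OF Suc_leD[OF Suc.prems]] step] by (simp only:)
  qed
  from this[of e] show ?thesis using weighted_power_subset_alg_power by blast
qed

text \<open>Serves the case \<open>d = 0\<close>. If the square of \<open>I\<close> is the whole
  algebra, then so is \<open>I\<close>, and hence every power of it.\<close>

lemma carrier_subset_alg_power:
  assumes "carrier A \<subseteq> alg_power F A I 2" "n \<ge> 1"
  shows "carrier A \<subseteq> alg_power F A I n"
  using assms(2)
proof (induction n rule: nat_induct_at_least)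
  case base
  have "alg_power F A I (Suc 1) \<subseteq> I"
    using I_subset I_mult_left by (intro alg_power_Suc_subset I_submodule) auto
  then show ?case using assms(1) by (simp add: numeral_2_eq_2)
next
  case (Suc n)
  have "alg_power F A I (Suc 1) \<subseteq> alg_power F A I (Suc n)"
    using Suc I_subset
    by (intro alg_power_Suc_subset alg_power_submodule mult_in_alg_power_Suc) auto
  then show ?case using assms(1) by (simp add: numeral_2_eq_2)
qed

end

theorem proposition5p4:
  fixes F :: "('f, 'x) ring_scheme" and R :: "('f, 'a, 'm) module_scheme"
    and I :: "'a set" and p c d :: nat
  assumes "assoc_algebra F R"
    and "field_char F = p" and "p > 2"
    and "two_sided_ideal F R I"
    and "alg_nilpotent F R I" and "nilpotence_index F R I = c" and "c \<ge> 1"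
    and "lie_nilpotent F (quot_algebra R (alg_power F R I 2))"
    and "lie_class F (quot_algebra R (alg_power F R I 2)) = d"
  shows "lie_gamma F R (mu c d) = {\<zero>\<^bsub>R\<^esub>}"
proof -
  let ?J = "alg_power F R I 2"
  interpret alg_ideal F R I
    using assms(1,4) by (simp add: alg_ideal_def alg_ideal_axioms_def)
  \<comment> \<open>A second instance, with the square of \<open>I\<close> as the ideal, supplies
    the quotient lemmas.\<close>
  interpret J: alg_ideal F R ?J
    using two_sided_ideal_alg_power[of 2] assms(1) by (simp add: alg_ideal_def alg_ideal_axioms_def)
  have c: "alg_power F R I (c + 1) = {\<zero>\<^bsub>R\<^esub>}"
    using assms(5,6) unfolding alg_nilpotent_def nilpotence_index_def by (metis (lifting) LeastI_ex)
  obtain n where "n \<ge> 1" "lie_gamma F (quot_algebra R ?J) n = {\<zero>\<^bsub>quot_algebra R ?J\<^esub>}"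
    using assms(8) by (auto simp: lie_nilpotent_def)
  \<comment> \<open>Puts the witness into the form \<open>m + 1\<close> over which
    \<open>lie_class\<close> takes the least value.\<close>
  then have "lie_gamma F (quot_algebra R ?J) (n - 1 + 1) = {\<zero>\<^bsub>quot_algebra R ?J\<^esub>}"
    by simp
  then have "lie_gamma F (quot_algebra R ?J) (d + 1) = {\<zero>\<^bsub>quot_algebra R ?J\<^esub>}"
    using assms(9) unfolding lie_class_def by (metis (lifting) LeastI)
  then have gamma: "lie_gamma F R (Suc d) \<subseteq> ?J"
    using J.lie_gamma_subset_ideal by simp
  have "lie_gamma F R (mu c d) \<subseteq> alg_power F R I (c + 1)"
  proof (cases d)
    case 0
    \<comment> \<open>Nilpotence makes \<open>R\<close> itself zero here, so the value of
      \<open>mu\<close> under truncated subtraction does not matter.\<close>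
    then have "carrier R \<subseteq> alg_power F R I (c + 1)"
      using carrier_subset_alg_power gamma by simp
    then show ?thesis using submoduleE(1)[OF lie_gamma_submodule] by blast
  next
    case (Suc f)
    obtain e where e: "c = Suc e" using assms(7) by (cases c) auto
    have "mu c d = Suc (Suc f + e * (2 * f + 1))"
      by (simp add: mu_def e Suc algebra_simps)
    then show ?thesis using lie_gamma_subset_alg_power[of f e] gamma e Suc by simp
  qed
  then show ?thesis using c submodule_zero[OF lie_gamma_submodule] by blast
qed

end
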